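(* Let $\{\mathbf{X}^n\}_{n\in\mathbb{N}_0}$ be a sequence of covers of a set $S$ and let $w\in\mathbb{N}_0$. Then the following are equivalent: (i) There is a metric $\varrho$ on $S$ such that $(S,\varrho)$ is bounded and $\{\mathbf{X}^n\}$ is a visual approximation of width $w$ for $(S,\varrho)$ (with some visual parameter $\Lambda>1$). (ii) There is a metric $d$ on $S$ such that $(S,d)$ is bounded and $\{\mathbf{X}^n\}$ is a quasi-visual approximation of width $w$ for $(S,d)$. (iii) $\{\mathbf{X}^n\}$ is a combinatorially visual approximation of width $w$ for $S$.
   Context: $\mathbb{N}_0=\{0,1,2,\dots\}$, $\mathbb{N}=\{1,2,\dots\}$. A cover $\mathbf{X}^n$ of $S$ is a collection (possibly infinite) of subsets of $S$ whose union is $S$; its elements are called $n$-tiles. For $X,Y\in\mathbf{X}^n$, a chain of $n$-tiles of length $k$ from $X$ to $Y$ is a finite sequence $X_0=X,X_1,\dots,X_k=Y$ of $n$-tiles with $X_j\cap X_{j+1}\ne\emptyset$ for all $j=0,\dots,k-1$. For $w\in\mathbb{N}_0$ and $X\in\mathbf{X}^n$, $U_w(X)$ is the union of all $Y\in\mathbf{X}^n$ for which there is a chain of $n$-tiles from $X$ to $Y$ of length $\le w$. For a metric $d$, $\operatorname{dist}(X,Y)=\inf\{d(x,y):x\in X,\,y\in Y\}$, and $\operatorname{diam}(X)$ is the diameter of $X$. Visual approximation: for $\Lambda>1$, a visual approximation of width $w$ with visual parameter $\Lambda$ for a bounded metric space $(S,\varrho)$ is a sequence $\{\mathbf{X}^n\}_{n\in\mathbb{N}_0}$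 of covers of $S$ with $\mathbf{X}^0=\{S\}$ for which there is $C\ge 1$ such that for all $n\in\mathbb{N}_0$ and $X,Y\in\mathbf{X}^n$: $\frac1C\Lambda^{-n}\le\operatorname{diam}(X)\le C\Lambda^{-n}$; and $\operatorname{dist}(X,Y)\ge\frac1C\Lambda^{-n}$ whenever $U_w(X)\cap U_w(Y)=\emptyset$. Quasi-visual approximation: for a bounded metric space $(S,d)$ with more than one point, a quasi-visual approximation of width $w$ is a sequence $\{\mathbf{X}^n\}_{n\in\mathbb{N}_0}$ of covers of $S$ with $\mathbf{X}^0=\{S\}$ for which there are constants $C\ge1$, $k_0\in\mathbb{N}$, $\lambda\in(0,1)$ such that for all $n\in\mathbb{N}_0$: (1) $\frac1C\operatorname{diam}(Y)\le\operatorname{diam}(X)\le C\operatorname{diam}(Y)$ for all $X,Y\in\mathbf{X}^n$ with $X\cap Y\neq\emptyset$; (2) $\operatorname{dist}(X,Y)\ge\frac1C\operatorname{diam}(X)$ for all $X,Y\in\mathbf{X}^n$ with $U_w(X)\cap U_w(Y)=\emptyset$; (3) $\frac1C\operatorname{diam}(Y)\le\operatorname{diam}(X)\le C\operatorname{diam}(Y)$ for all $X\in\mathbf{X}^n$, $Y\in\mathbf{X}^{n+1}$ with $X\cap Y\ne\emptyset$; (4) $\operatorname{diam}(Y)\le\lambda\operatorname{diam}(X)$ for all $X\in\mathbf{X}^n$, $Y\in\mathbf{X}^{n+k_0}$ with $X\cap Y\ne\emptyset$. Proximity function: for $x,y\in S$, $m_w(x,y)\in\mathbb{N}_0\cup\{\infty\}$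 is the supremum of all $n\in\mathbb{N}_0$ for which there exist $X,Y\in\mathbf{X}^n$ with $x\in X$, $y\in Y$ and $U_w(X)\cap U_w(Y)\ne\emptyset$. Combinatorially visual approximation: a sequence $\{\mathbf{X}^n\}_{n\in\mathbb{N}_0}$ of covers of $S$ with $\mathbf{X}^0=\{S\}$ is a combinatorially visual approximation of width $w$ for $S$ if there is a constant $C\ge0$ such that: (a) $m_w(x,y)\in\mathbb{N}_0$ for all distinct $x,y\in S$; (b) for all $n\in\mathbb{N}_0$ and $X^n\in\mathbf{X}^n$ there exist $x,y\in X^n$ with $m_w(x,y)\le n+C$; (c) if $n\in\mathbb{N}_0$, $X^n,Y^n\in\mathbf{X}^n$ and $U_w(X^n)\cap U_w(Y^n)=\emptyset$, then $m_w(x,y)\le n+C$ for all $x\in X^n$, $y\in Y^n$; (d) $m_w(x,y)\ge\min\{m_w(x,z),m_w(z,y)\}-C$ for all $x,y,z\in S$. *)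

theory Defs
  imports "HOL-Analysis.Analysis"
begin

(* The metrics are functions d with "Metric_space S d" for the given carrier S, not the type-class
   metric, because the theorem asks for the existence of a metric on S. *)

(* Diameter and distance of sets for such a d, with the conventions of the library's
   "diameter" and "setdist": both are 0 if a set involved is empty. This matters only for covers
   with an empty tile, which the definition of a cover allows: with infinite distance to the empty
   set, a quasi-visual approximation could have empty tiles while a visual or a combinatorially
   visual one cannot. With distance 0, the distance condition of a quasi-visual approximation rules them
   out as well. *)

definition set_diam :: "('a \<Rightarrow> 'a \<Rightarrow> real) \<Rightarrow> 'a set \<Rightarrow> real" where
  "set_diam d A = (if A = {} then 0 else (SUP (x, y) \<in> A \<times> A. d x y))"

definition set_dist :: "('a \<Rightarrow> 'a \<Rightarrow> real) \<Rightarrow> 'a set \<Rightarrow> 'a set \<Rightarrow> real" where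
  "set_dist d A B = (if A = {} \<or> B = {} then 0 else (INF (x, y) \<in> A \<times> B. d x y))"

definition is_cover :: "'a set \<Rightarrow> 'a set set \<Rightarrow> bool" where
  "is_cover S T \<longleftrightarrow> \<Union>T = S"

definition is_chain :: "'a set set \<Rightarrow> nat \<Rightarrow> (nat \<Rightarrow> 'a set) \<Rightarrow> 'a set \<Rightarrow> 'a set \<Rightarrow> bool" where
  "is_chain T k Z A B \<longleftrightarrow>
     Z 0 = A \<and> Z k = B \<and> (\<forall>j\<le>k. Z j \<in> T) \<and> (\<forall>j<k. Z j \<inter> Z (Suc j) \<noteq> {})"

definition tile_nbhd :: "'a set set \<Rightarrow> nat \<Rightarrow> 'a set \<Rightarrow> 'a set" where
  "tile_nbhd T w A = \<Union>{B \<in> T. \<exists>k\<le>w. \<exists>Z. is_chain T k Z A B}"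

definition visual_approximation ::
    "'a set \<Rightarrow> ('a \<Rightarrow> 'a \<Rightarrow> real) \<Rightarrow> (nat \<Rightarrow> 'a set set) \<Rightarrow> nat \<Rightarrow> real \<Rightarrow> bool" where
  "visual_approximation S d X w \<Lambda> \<longleftrightarrow>
     (\<forall>n. is_cover S (X n)) \<and> X 0 = {S} \<and>
     (\<exists>C\<ge>1.
        (\<forall>n. \<forall>A\<in>X n. 1 / C * \<Lambda> powi (- int n) \<le> set_diam d A \<and>
                     set_diam d A \<le> C * \<Lambda> powi (- int n)) \<and>
        (\<forall>n. \<forall>A\<in>X n. \<forall>B\<in>X n. tile_nbhd (X n) w A \<inter> tile_nbhd (X n) w B = {} \<longrightarrow>
                     set_dist d A B \<ge> 1 / C * \<Lambda> powi (- int n)))"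

definition quasi_visual_approximation ::
    "'a set \<Rightarrow> ('a \<Rightarrow> 'a \<Rightarrow> real) \<Rightarrow> (nat \<Rightarrow> 'a set set) \<Rightarrow> nat \<Rightarrow> bool" where
  "quasi_visual_approximation S d X w \<longleftrightarrow>
     (\<exists>x\<in>S. \<exists>y\<in>S. x \<noteq> y) \<and>
     (\<forall>n. is_cover S (X n)) \<and> X 0 = {S} \<and>
     (\<exists>(C::real) (k\<^sub>0::nat) (\<theta>::real). C \<ge> 1 \<and> k\<^sub>0 \<ge> 1 \<and> 0 < \<theta> \<and> \<theta> < 1 \<and>
        (\<forall>n. \<forall>A\<in>X n. \<forall>B\<in>X n. A \<inter> B \<noteq> {} \<longrightarrow>
           1 / C * set_diam d B \<le> set_diam d A \<and> set_diam d A \<le> C * set_diam d B) \<and>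
        (\<forall>n. \<forall>A\<in>X n. \<forall>B\<in>X n. tile_nbhd (X n) w A \<inter> tile_nbhd (X n) w B = {} \<longrightarrow>
           set_dist d A B \<ge> 1 / C * set_diam d A) \<and>
        (\<forall>n. \<forall>A\<in>X n. \<forall>B\<in>X (n + 1). A \<inter> B \<noteq> {} \<longrightarrow>
           1 / C * set_diam d B \<le> set_diam d A \<and> set_diam d A \<le> C * set_diam d B) \<and>
        (\<forall>n. \<forall>A\<in>X n. \<forall>B\<in>X (n + k\<^sub>0). A \<inter> B \<noteq> {} \<longrightarrow>
           set_diam d B \<le> \<theta> * set_diam d A))"

definition proximity :: "(nat \<Rightarrow> 'a set set) \<Rightarrow> nat \<Rightarrow> 'a \<Rightarrow> 'a \<Rightarrow> enat" where
  "proximity X w x y =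
     Sup {enat n |n. \<exists>A\<in>X n. \<exists>B\<in>X n. x \<in> A \<and> y \<in> B \<and>
                       tile_nbhd (X n) w A \<inter> tile_nbhd (X n) w B \<noteq> {}}"

(* C is a real constant, so the inequalities are taken in ereal; the proximity of a point
   to itself is usually infinite. *)
definition combinatorially_visual_approximation ::
    "'a set \<Rightarrow> (nat \<Rightarrow> 'a set set) \<Rightarrow> nat \<Rightarrow> bool" where
  "combinatorially_visual_approximation S X w \<longleftrightarrow>
     (\<forall>n. is_cover S (X n)) \<and> X 0 = {S} \<and>
     (let m = (\<lambda>x y. ereal_of_enat (proximity X w x y)) in
      \<exists>C::real. C \<ge> 0 \<and>
        (\<forall>x\<in>S. \<forall>y\<in>S. x \<noteq> y \<longrightarrow> proximity X w x y \<noteq> \<infinity>) \<and>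
        (\<forall>n. \<forall>A\<in>X n. \<exists>x\<in>A. \<exists>y\<in>A. m x y \<le> ereal (real n + C)) \<and>
        (\<forall>n. \<forall>A\<in>X n. \<forall>B\<in>X n. tile_nbhd (X n) w A \<inter> tile_nbhd (X n) w B = {} \<longrightarrow>
           (\<forall>x\<in>A. \<forall>y\<in>B. m x y \<le> ereal (real n + C))) \<and>
        (\<forall>x\<in>S. \<forall>y\<in>S. \<forall>z\<in>S. m x y \<ge> min (m x z) (m z y) - ereal C))"

end

theory Submission
  imports Defs
begin

text \<open>
  The proximity \<open>m x y\<close> of two points is the last level at which the tiles around them cannot be
  told apart, so in a visual metric with parameter \<open>\<Lambda>\<close> the distance of \<open>x\<close> and \<open>y\<close> must be comparable
  to \<open>\<Lambda>\<close> to the power \<open>- m x y\<close>. For each \<open>\<Lambda>\<close> this determines the metric up to a factor, in terms of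
  the covers alone.

  A visual approximation is quasi-visual because the diameters of two tiles are then comparable to
  powers of \<open>\<Lambda>\<close> that depend only on the levels.

  In a quasi-visual approximation the distance of \<open>x\<close> and \<open>y\<close> is comparable to the diameter of a tile
  at \<open>x\<close> of level \<open>m x y\<close>: neighbourhoods that meet give a short chain of tiles of comparable size
  from \<open>x\<close> to \<open>y\<close> (\<open>near_upper_estimate\<close>), while at the next level the neighbourhoods are disjoint
  and separation applies (\<open>not_near_lower_estimate\<close>). As diameters decay exponentially with the level
  (\<open>diam_decay\<close>), points that are near at a level much finer than that of a tile are close compared
  with this tile (\<open>near_fine_level\<close>). So inequalities between distances, such as the triangle
  inequality, become inequalities between proximities up to an additive constant, which makes the
  approximation combinatorially visual.

  In a combinatorially visual approximation with constant \<open>N\<close>, the function \<open>\<Lambda>\<close> to the power \<open>- m x y\<close>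
  satisfies the ultrametric inequality up to the factor \<open>\<Lambda> ^ N\<close>. If \<open>\<Lambda>\<close> is close enough to one, the
  square of this factor is at most two, and then Frink's chain construction yields a metric that
  agrees with the function up to a factor two (\<open>chain_metric_le\<close>, \<open>chain_metric_ge\<close>). The remaining
  conditions make the covers a visual approximation for this metric.
\<close>

section \<open>Diameter and distance of sets in a bounded metric\<close>

lemma set_diam_upper:
  assumes "\<And>x y. x \<in> A \<Longrightarrow> y \<in> A \<Longrightarrow> d x y \<le> b" and "x \<in> A" "y \<in> A"
  shows "d x y \<le> set_diam d A"
proof -
  have "bdd_above ((\<lambda>(x, y). d x y) ` (A \<times> A))"
    using assms(1) by (auto intro!: bdd_aboveI[of _ b])
  then have "(\<lambda>(x, y). d x y) (x, y) \<le> (SUP (x, y) \<in> A \<times> A. d x y)"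
    using assms by (intro cSUP_upper) auto
  then show ?thesis using assms by (auto simp: set_diam_def)
qed

lemma set_diam_least:
  assumes "A \<noteq> {}" and "\<And>x y. x \<in> A \<Longrightarrow> y \<in> A \<Longrightarrow> d x y \<le> b"
  shows "set_diam d A \<le> b"
  unfolding set_diam_def using assms by (auto intro!: cSUP_least)

lemma less_set_diamE:
  assumes "A \<noteq> {}" and "t < set_diam d A"
  obtains x y where "x \<in> A" "y \<in> A" "t < d x y"
  using set_diam_least[OF assms(1), of d t] assms(2) by (meson not_le)

lemma set_dist_lower:
  assumes "\<And>x y. 0 \<le> d x y" and "x \<in> A" "y \<in> B"
  shows "set_dist d A B \<le> d x y"
proof -
  have "bdd_below ((\<lambda>(x, y). d x y) ` (A \<times> B))"
    using assms(1) by (auto intro!: bdd_belowI[of _ 0])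
  then have "(INF (x, y) \<in> A \<times> B. d x y) \<le> (\<lambda>(x, y). d x y) (x, y)"
    using assms by (intro cINF_lower) auto
  then show ?thesis using assms by (auto simp: set_dist_def)
qed

lemma set_dist_greatest:
  assumes "A \<noteq> {}" "B \<noteq> {}" and "\<And>x y. x \<in> A \<Longrightarrow> y \<in> B \<Longrightarrow> b \<le> d x y"
  shows "b \<le> set_dist d A B"
  unfolding set_dist_def using assms by (auto intro!: cINF_greatest)

lemma mbounded_carrierE:
  assumes "Metric_space S d" and "Metric_space.mbounded S d S"
  obtains b where "\<And>x y. x \<in> S \<Longrightarrow> y \<in> S \<Longrightarrow> d x y \<le> b"
  using assms Metric_space.mbounded_alt by metis

section \<open>Proximity in terms of single levels\<close>

definition near :: "(nat \<Rightarrow> 'a set set) \<Rightarrow> nat \<Rightarrow> nat \<Rightarrow> 'a \<Rightarrow> 'a \<Rightarrow> bool" where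
  "near X w n x y \<longleftrightarrow> (\<exists>A\<in>X n. \<exists>B\<in>X n. x \<in> A \<and> y \<in> B \<and>
     tile_nbhd (X n) w A \<inter> tile_nbhd (X n) w B \<noteq> {})"

lemma near_sym: "near X w n x y \<Longrightarrow> near X w n y x"
  unfolding near_def by (metis inf_commute)

lemma subset_tile_nbhd:
  assumes "A \<in> T"
  shows "A \<subseteq> tile_nbhd T w A"
proof -
  have "is_chain T 0 (\<lambda>_. A) A A" using assms by (simp add: is_chain_def)
  then show ?thesis using assms unfolding tile_nbhd_def by blast
qed

lemma near_same_tile:
  assumes "A \<in> X n" "x \<in> A" "y \<in> A"
  shows "near X w n x y"
  unfolding near_def using assms subset_tile_nbhd[OF assms(1), of w] by blast

lemma proximity_near: "proximity X w x y = Sup {enat n |n. near X w n x y}"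
  by (simp add: proximity_def near_def)

lemma proximity_commute: "proximity X w x y = proximity X w y x"
  unfolding proximity_near by (metis near_sym)

lemma near_le_proximity: "near X w n x y \<Longrightarrow> enat n \<le> proximity X w x y"
  unfolding proximity_near by (rule Sup_upper) auto

lemma proximity_le_iff: "proximity X w x y \<le> enat k \<longleftrightarrow> (\<forall>n. near X w n x y \<longrightarrow> n \<le> k)"
  unfolding proximity_near Sup_le_iff by auto

text \<open>The supremum in the definition of the proximity is attained when it is finite, provided that
  the set of levels is not empty.\<close>

lemma near_proximity:
  assumes "near X w 0 x y" and "proximity X w x y = enat m"
  shows "near X w m x y"
proof (rule ccontr)
  assume not_near: "\<not> near X w m x y"
  with assms(1) obtain k where k: "m = Suc k" by (metis not0_implies_Suc)
  have "n \<le> k" if "near X w n x y" for n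
    using near_le_proximity[OF that] that not_near assms(2) k by (auto simp: le_Suc_eq)
  then have "proximity X w x y \<le> enat k" by (simp add: proximity_le_iff)
  then show False using assms(2) k by simp
qed

lemma proximity_self:
  assumes "\<And>n. is_cover S (X n)" and "x \<in> S"
  shows "proximity X w x x = \<infinity>"
proof -
  have "near X w n x x" for n
    using assms near_same_tile[of _ X n x x w] unfolding is_cover_def by blast
  then have "enat n \<le> proximity X w x x" for n by (rule near_le_proximity)
  then show ?thesis by (metis Suc_ile_eq enat.exhaust less_irrefl)
qed

lemma ereal_of_enat_le_real_iff: "ereal_of_enat a \<le> ereal (real n) \<longleftrightarrow> a \<le> enat n"
  by (cases a) auto

text \<open>Proximities are integers or infinite, so the real constant may be rounded up to a natural
  number; all the inequalities then take place in the extended naturals.\<close>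

lemma combinatorially_visual_iff:
  "combinatorially_visual_approximation S X w \<longleftrightarrow>
     (\<forall>n. is_cover S (X n)) \<and> X 0 = {S} \<and>
     (\<forall>x\<in>S. \<forall>y\<in>S. x \<noteq> y \<longrightarrow> proximity X w x y \<noteq> \<infinity>) \<and>
     (\<exists>N::nat.
        (\<forall>n. \<forall>A\<in>X n. \<exists>x\<in>A. \<exists>y\<in>A. proximity X w x y \<le> enat (n + N)) \<and>
        (\<forall>n. \<forall>A\<in>X n. \<forall>B\<in>X n. tile_nbhd (X n) w A \<inter> tile_nbhd (X n) w B = {} \<longrightarrow>
           (\<forall>x\<in>A. \<forall>y\<in>B. proximity X w x y \<le> enat (n + N))) \<and>
        (\<forall>x\<in>S. \<forall>y\<in>S. \<forall>z\<in>S.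
           min (proximity X w x z) (proximity X w z y) \<le> proximity X w x y + enat N))"
    (is "_ \<longleftrightarrow> ?cov \<and> ?top \<and> ?fin \<and> (\<exists>N. ?Q N)")
proof -
  define m where "m = (\<lambda>x y. ereal_of_enat (proximity X w x y))"
  define P1 where "P1 C \<longleftrightarrow> (\<forall>n. \<forall>A\<in>X n. \<exists>x\<in>A. \<exists>y\<in>A. m x y \<le> ereal (real n + C))" for C
  define P2 where "P2 C \<longleftrightarrow>
      (\<forall>n. \<forall>A\<in>X n. \<forall>B\<in>X n. tile_nbhd (X n) w A \<inter> tile_nbhd (X n) w B = {} \<longrightarrow>
         (\<forall>x\<in>A. \<forall>y\<in>B. m x y \<le> ereal (real n + C)))" for C
  define P3 where "P3 C \<longleftrightarrow> (\<forall>x\<in>S. \<forall>y\<in>S. \<forall>z\<in>S. m x y \<ge> min (m x z) (m z y) - ereal C)" for C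
  have unfold: "combinatorially_visual_approximation S X w \<longleftrightarrow>
      ?cov \<and> ?top \<and> (\<exists>C\<ge>0. ?fin \<and> P1 C \<and> P2 C \<and> P3 C)"
    unfolding combinatorially_visual_approximation_def Let_def P1_def P2_def P3_def m_def ..
  have le: "m x y \<le> ereal (real n + real N) \<longleftrightarrow> proximity X w x y \<le> enat (n + N)" for x y n N
    unfolding m_def using ereal_of_enat_le_real_iff[of "proximity X w x y" "n + N"] by simp
  have minus: "min (ereal_of_enat a) (ereal_of_enat b) - ereal (real N) \<le> ereal_of_enat c
      \<longleftrightarrow> min a b \<le> c + enat N" for a b c N
    by (cases a; cases b; cases c) (auto simp: min_def)
  have round: "P1 (real N) \<and> P2 (real N) \<and> P3 (real N) \<longleftrightarrow> ?Q N" for N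
    unfolding P1_def P2_def P3_def le unfolding m_def minus ..
  have up: "P1 C' \<and> P2 C' \<and> P3 C'" if P: "P1 C \<and> P2 C \<and> P3 C" and "C \<le> C'" for C C'
  proof -
    have le1: "ereal (real n + C) \<le> ereal (real n + C')" for n using \<open>C \<le> C'\<close> by simp
    have le2: "b - ereal C' \<le> b - ereal C" for b using \<open>C \<le> C'\<close> by (intro ereal_minus_mono) auto
    have "P1 C'" using P le1 unfolding P1_def by (meson order_trans)
    moreover have "P2 C'" using P le1 unfolding P2_def by (meson order_trans)
    moreover have "P3 C'" using P le2 unfolding P3_def by (meson order_trans)
    ultimately show ?thesis by blast
  qed
  have "(\<exists>C\<ge>0. ?fin \<and> P1 C \<and> P2 C \<and> P3 C) \<longleftrightarrow> ?fin \<and> (\<exists>N. ?Q N)"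
  proof
    assume "\<exists>C\<ge>0. ?fin \<and> P1 C \<and> P2 C \<and> P3 C"
    then obtain C where "?fin" and C: "P1 C \<and> P2 C \<and> P3 C" by blast
    have "?Q (nat \<lceil>C\<rceil>)" by (rule up[OF C real_nat_ceiling_ge, unfolded round])
    with \<open>?fin\<close> show "?fin \<and> (\<exists>N. ?Q N)" by (intro conjI[OF _ exI])
  next
    assume Q: "?fin \<and> (\<exists>N. ?Q N)"
    from conjunct2[OF Q] obtain N where "?Q N" by (rule exE)
    then have "P1 (real N) \<and> P2 (real N) \<and> P3 (real N)" by (simp only: round)
    then show "\<exists>C\<ge>0. ?fin \<and> P1 C \<and> P2 C \<and> P3 C"
      using conjunct1[OF Q] of_nat_0_le_iff by blast
  qed
  then show ?thesis unfolding unfold by (rule arg_cong)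
qed

section \<open>Visual approximations are quasi-visual\<close>

lemma visual_imp_quasi_visual:
  assumes "Metric_space S d" and "1 < \<Lambda>" and vis: "visual_approximation S d X w \<Lambda>"
  shows "quasi_visual_approximation S d X w"
proof -
  obtain C where C: "C \<ge> 1"
    and diam_bounds: "\<forall>n. \<forall>A\<in>X n. 1 / C * \<Lambda> powi (- int n) \<le> set_diam d A \<and>
                     set_diam d A \<le> C * \<Lambda> powi (- int n)"
    and dist_bound: "\<forall>n. \<forall>A\<in>X n. \<forall>B\<in>X n. tile_nbhd (X n) w A \<inter> tile_nbhd (X n) w B = {} \<longrightarrow>
                     set_dist d A B \<ge> 1 / C * \<Lambda> powi (- int n)"
    using vis unfolding visual_approximation_def by (elim conjE exE) (rule that)
  have diam: "1 / C * \<Lambda> powi (- int n) \<le> set_diam d A" "set_diam d A \<le> C * \<Lambda> powi (- int n)"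
    if "A \<in> X n" for n A
    using diam_bounds that by blast+
  have dist: "set_dist d A B \<ge> 1 / C * \<Lambda> powi (- int n)"
    if "A \<in> X n" "B \<in> X n" "tile_nbhd (X n) w A \<inter> tile_nbhd (X n) w B = {}" for n A B
    using dist_bound that by blast
  have cov: "\<forall>n. is_cover S (X n)" and X0: "X 0 = {S}"
    using vis unfolding visual_approximation_def by auto
  interpret Metric_space S d by fact
  define r where "r = 1 / \<Lambda>"
  have r: "0 < r" "r < 1" using \<open>1 < \<Lambda>\<close> by (auto simp: r_def)
  have powi: "\<Lambda> powi (- int n) = r ^ n" for n
    by (simp add: r_def power_int_minus power_one_over inverse_eq_divide)
  note diam = diam[unfolded powi] and dist = dist[unfolded powi]
  \<comment> \<open>Any two tiles are compared through the powers of \<open>r\<close> that their levels prescribe.\<close>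
  have compare: "r ^ j * set_diam d A \<le> C\<^sup>2 * set_diam d B" if "A \<in> X n" "B \<in> X m" "m \<le> j + n"
    for j n m A B
  proof -
    have "r ^ j * set_diam d A \<le> r ^ j * (C * r ^ n)"
      using diam(2)[OF that(1)] r by (intro mult_left_mono) auto
    also have "\<dots> = C * r ^ (j + n)" by (simp add: power_add)
    also have "\<dots> \<le> C * r ^ m" using that r C by (intro mult_left_mono power_decreasing) auto
    also have "\<dots> = C\<^sup>2 * (1 / C * r ^ m)" using C by (simp add: power2_eq_square)
    also have "\<dots> \<le> C\<^sup>2 * set_diam d B" using diam(1)[OF that(2)] by (intro mult_left_mono) auto
    finally show ?thesis .
  qed
  obtain k where k: "r ^ k < 1 / (2 * C\<^sup>2)"
    using real_arch_pow_inv[of "1 / (2 * C\<^sup>2)" r] r C by auto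
  have diam_nonneg: "0 \<le> set_diam d A" if "A \<in> X n" for n A
    using diam(1)[OF that] C r by (smt (verit) divide_nonneg_nonneg mult_nonneg_nonneg zero_le_power)
  define C' where "C' = C\<^sup>2 * \<Lambda>"
  have "1 \<le> C\<^sup>2" using C by simp
  then have C': "C' \<ge> C\<^sup>2" "C' \<ge> 1" "C' > 0"
    using \<open>1 < \<Lambda>\<close> mult_left_mono[of 1 \<Lambda> "C\<^sup>2"] by (auto simp: C'_def)
  have same: "set_diam d A \<le> C' * set_diam d B" if "A \<in> X n" "B \<in> X n" for n A B
    using compare[OF that, of 0] C'(1) diam_nonneg[OF that(2)] mult_right_mono[of "C\<^sup>2" C' "set_diam d B"]
    by simp
  have next_le: "set_diam d B \<le> C' * set_diam d A" if "A \<in> X n" "B \<in> X (n + 1)" for n A B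
    using compare[OF that(2,1), of 0] C'(1) diam_nonneg[OF that(1)] mult_right_mono[of "C\<^sup>2" C' "set_diam d A"]
    by simp
  have next_ge: "set_diam d A \<le> C' * set_diam d B" if "A \<in> X n" "B \<in> X (n + 1)" for n A B
    using compare[OF that, of 1] \<open>1 < \<Lambda>\<close> by (simp add: r_def C'_def field_simps)
  have jump: "set_diam d B \<le> 1/2 * set_diam d A" if "A \<in> X n" "B \<in> X (n + Suc k)" for n A B
  proof -
    have "set_diam d B \<le> C * r ^ (n + Suc k)" by (rule diam(2)[OF that(2)])
    also have "\<dots> \<le> C * r ^ (n + k)" using r C by (intro mult_left_mono power_decreasing) auto
    also have "\<dots> = C * r ^ n * r ^ k" by (simp add: power_add)
    also have "\<dots> \<le> C * r ^ n * (1 / (2 * C\<^sup>2))" using k C r by (intro mult_left_mono) auto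
    also have "\<dots> = 1/2 * (1 / C * r ^ n)" using C by (simp add: power2_eq_square)
    also have "\<dots> \<le> 1/2 * set_diam d A" using diam(1)[OF that(1)] by simp
    finally show ?thesis .
  qed
  have far: "set_dist d A B \<ge> 1 / C' * set_diam d A"
    if "A \<in> X n" "B \<in> X n" "tile_nbhd (X n) w A \<inter> tile_nbhd (X n) w B = {}" for n A B
  proof -
    have "set_diam d A \<le> C\<^sup>2 * (1 / C * r ^ n)"
      using diam(2)[OF that(1)] C by (simp add: power2_eq_square)
    also have "\<dots> \<le> C' * (1 / C * r ^ n)" using C' C r by (intro mult_right_mono) auto
    also have "\<dots> \<le> C' * set_dist d A B" using dist[OF that] C' by (intro mult_left_mono) auto
    finally show ?thesis using C' by (simp add: field_simps)
  qed
  have two: "\<exists>x\<in>S. \<exists>y\<in>S. x \<noteq> y"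
  proof -
    have "0 < 1 / C" using C by simp
    moreover have "1 / C \<le> set_diam d S" using diam(1)[of S 0] X0 by simp
    ultimately have pos: "0 < set_diam d S" by linarith
    then have "S \<noteq> {}" by (auto simp: set_diam_def)
    then obtain x y where "x \<in> S" "y \<in> S" "0 < d x y" using less_set_diamE pos by metis
    then show ?thesis using zero by (metis less_irrefl)
  qed
  have flip: "1 / C' * a \<le> b \<longleftrightarrow> a \<le> C' * b" for a b using C' by (simp add: field_simps)
  have same': "1 / C' * set_diam d B \<le> set_diam d A" if "A \<in> X n" "B \<in> X n" for n A B
    unfolding flip by (rule same[OF that(2,1)])
  have next': "1 / C' * set_diam d B \<le> set_diam d A" if "A \<in> X n" "B \<in> X (n + 1)" for n A B
    unfolding flip by (rule next_le[OF that])
  show ?thesis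
    unfolding quasi_visual_approximation_def
  proof (intro conjI two cov X0, rule exI[of _ C'], rule exI[of _ "Suc k"], rule exI[of _ "1/2"],
      intro conjI allI ballI impI)
  qed (use C'(2) same' same next' next_ge far jump in simp_all)
qed

section \<open>Quasi-visual approximations are combinatorially visual\<close>

text \<open>The conditions are solved for the diameters, so that no division occurs. The comparison of
  tiles of the same level is stated in one direction, as the two tiles may be exchanged.\<close>

locale quasi_visual = Metric_space S d for S :: "'a set" and d +
  fixes X :: "nat \<Rightarrow> 'a set set" and w :: nat and C :: real and k\<^sub>0 :: nat and \<theta> :: real
  assumes cover: "is_cover S (X n)" and level_zero: "X 0 = {S}"
    and bounded: "mbounded S" and two_points: "\<exists>x\<in>S. \<exists>y\<in>S. x \<noteq> y"
    and C_ge_1: "1 \<le> C" and k0_ge_1: "1 \<le> k\<^sub>0" and \<theta>: "0 < \<theta>" "\<theta> < 1"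
    and same_level: "\<lbrakk>A \<in> X n; B \<in> X n; A \<inter> B \<noteq> {}\<rbrakk> \<Longrightarrow> set_diam d A \<le> C * set_diam d B"
    and separated: "\<lbrakk>A \<in> X n; B \<in> X n; tile_nbhd (X n) w A \<inter> tile_nbhd (X n) w B = {}\<rbrakk>
        \<Longrightarrow> set_diam d A \<le> C * set_dist d A B"
    and next_level_le: "\<lbrakk>A \<in> X n; B \<in> X (Suc n); A \<inter> B \<noteq> {}\<rbrakk> \<Longrightarrow> set_diam d B \<le> C * set_diam d A"
    and next_level_ge: "\<lbrakk>A \<in> X n; B \<in> X (Suc n); A \<inter> B \<noteq> {}\<rbrakk> \<Longrightarrow> set_diam d A \<le> C * set_diam d B"
    and jump: "\<lbrakk>A \<in> X n; B \<in> X (n + k\<^sub>0); A \<inter> B \<noteq> {}\<rbrakk> \<Longrightarrow> set_diam d B \<le> \<theta> * set_diam d A"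
begin

abbreviation diam :: "'a set \<Rightarrow> real" where "diam \<equiv> set_diam d"

lemma tile_subset: "A \<in> X n \<Longrightarrow> A \<subseteq> S"
  using cover[of n] unfolding is_cover_def by blast

lemma tile_containing:
  assumes "x \<in> S"
  obtains A where "A \<in> X n" "x \<in> A"
  using cover[of n] assms unfolding is_cover_def by blast

lemma dist_le_diam:
  assumes "A \<subseteq> S" "x \<in> A" "y \<in> A"
  shows "d x y \<le> diam A"
proof -
  obtain b where "\<And>x y. x \<in> S \<Longrightarrow> y \<in> S \<Longrightarrow> d x y \<le> b"
    using mbounded_carrierE[OF _ bounded] Metric_space_axioms by blast
  then show ?thesis using assms by (intro set_diam_upper[of A d b]) auto
qed

lemma diam_nonneg:
  assumes "A \<subseteq> S"
  shows "0 \<le> diam A"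
proof (cases "A = {}")
  case False
  then obtain x where "x \<in> A" by blast
  then show ?thesis using dist_le_diam[OF assms, of x x] nonneg[of x x] by linarith
qed (simp add: set_diam_def)

text \<open>Climbing from a tile to the coarsest level multiplies the diameter by at most \<open>C\<close> per level.
  As the whole space has more than one point, this keeps the diameters of tiles positive.\<close>

lemma diam_S_le:
  assumes "A \<in> X n" "x \<in> A"
  shows "diam S \<le> C ^ n * diam A"
  using assms
proof (induction n arbitrary: A)
  case 0
  then show ?case using level_zero by simp
next
  case (Suc n)
  have "x \<in> S" using Suc.prems tile_subset by blast
  then obtain B where B: "B \<in> X n" "x \<in> B" by (rule tile_containing)
  have "diam S \<le> C ^ n * diam B" by (rule Suc.IH[OF B])
  also have "\<dots> \<le> C ^ n * (C * diam A)"
    using next_level_ge[OF B(1) Suc.prems(1)] B Suc.prems C_ge_1 by (intro mult_left_mono) auto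
  finally show ?case by (simp add: mult_ac)
qed

lemma diam_S_pos: "0 < diam S"
  using two_points dist_le_diam[of S] mdist_pos_eq by (metis order_less_le_trans subset_refl)

lemma diam_pos_if_nonempty:
  assumes "A \<in> X n" "A \<noteq> {}"
  shows "0 < diam A"
proof -
  obtain x where "x \<in> A" using assms by blast
  then have "0 < C ^ n * diam A" using diam_S_le[OF assms(1)] diam_S_pos by fastforce
  then show ?thesis using C_ge_1 by (simp add: zero_less_mult_iff)
qed

text \<open>An empty tile would have an empty neighbourhood and distance zero to every tile of its
  level, which by separation forces these to have diameter zero.\<close>

lemma tile_nonempty:
  assumes "A \<in> X n"
  shows "A \<noteq> {}"
proof
  assume empty: "A = {}"
  have "Z k = {}" if "is_chain (X n) k Z A B" for k Z B
    using that empty by (cases k) (auto simp: is_chain_def)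
  then have "tile_nbhd (X n) w A = {}" unfolding tile_nbhd_def is_chain_def by blast
  moreover obtain x where "x \<in> S" using two_points by blast
  then obtain B where B: "B \<in> X n" "x \<in> B" by (rule tile_containing)
  ultimately have "diam B \<le> C * set_dist d B A" using separated assms by blast
  then have "diam B \<le> 0" using empty by (simp add: set_dist_def)
  then show False using diam_pos_if_nonempty[OF B(1)] B(2) by force
qed

lemma diam_pos: "A \<in> X n \<Longrightarrow> 0 < diam A"
  using diam_pos_if_nonempty tile_nonempty by blast

text \<open>Along a chain consecutive diameters change by at most the factor \<open>C\<close>, and the distance of two
  points in the end tiles is at most the sum of the diameters of the \<open>k + 1\<close> tiles.\<close>

lemma chain_estimate:
  assumes "is_chain (X n) k Z A B"
  shows "diam B \<le> C ^ k * diam A"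
    and "\<lbrakk>x \<in> A; y \<in> B\<rbrakk> \<Longrightarrow> d x y \<le> (real k + 1) * C ^ k * diam A"
proof -
  have "diam B \<le> C ^ k * diam A \<and> (\<forall>x\<in>A. \<forall>y\<in>B. d x y \<le> (real k + 1) * C ^ k * diam A)"
    using assms
  proof (induction k arbitrary: B)
    case 0
    then have "A \<in> X n" "B = A" by (auto simp: is_chain_def)
    then show ?case using dist_le_diam[OF tile_subset] by auto
  next
    case (Suc k)
    let ?D = "Z k"
    have tiles: "A \<in> X n" "?D \<in> X n" "B \<in> X n" and meet: "?D \<inter> B \<noteq> {}"
      using Suc.prems by (auto simp: is_chain_def)
    have "is_chain (X n) k Z A ?D" using Suc.prems by (auto simp: is_chain_def)
    note IH = Suc.IH[OF this]
    have diam_B: "diam B \<le> C ^ Suc k * diam A"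
    proof -
      have "diam B \<le> C * diam ?D" using same_level[OF tiles(3,2)] meet by auto
      also have "\<dots> \<le> C * (C ^ k * diam A)" using IH C_ge_1 by (intro mult_left_mono) auto
      finally show ?thesis by (simp add: mult_ac)
    qed
    have "d x y \<le> (real (Suc k) + 1) * C ^ Suc k * diam A" if "x \<in> A" "y \<in> B" for x y
    proof -
      obtain z where z: "z \<in> ?D" "z \<in> B" using meet by blast
      have "x \<in> S" "y \<in> S" "z \<in> S" using that z tiles tile_subset by blast+
      then have "d x y \<le> d x z + d z y" by (intro triangle)
      also have "d x z \<le> (real k + 1) * C ^ k * diam A" using IH that z by blast
      also have "\<dots> \<le> (real k + 1) * C ^ Suc k * diam A"
        using C_ge_1 diam_pos[OF tiles(1)] by (intro mult_right_mono mult_left_mono power_increasing) auto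
      also have "d z y \<le> C ^ Suc k * diam A"
        using dist_le_diam[OF tile_subset[OF tiles(3)] z(2) that(2)] diam_B by linarith
      finally show ?thesis by (simp add: algebra_simps)
    qed
    then show ?case using diam_B by blast
  qed
  then show "diam B \<le> C ^ k * diam A"
    and "\<lbrakk>x \<in> A; y \<in> B\<rbrakk> \<Longrightarrow> d x y \<le> (real k + 1) * C ^ k * diam A" by auto
qed

lemma is_chain_reverse:
  assumes "is_chain T k Z A B"
  shows "is_chain T k (\<lambda>j. Z (k - j)) B A"
proof -
  have "Z (k - j) \<inter> Z (k - Suc j) \<noteq> {}" if "j < k" for j
  proof -
    have "Z (k - Suc j) \<inter> Z (Suc (k - Suc j)) \<noteq> {}"
      using assms that unfolding is_chain_def by (metis diff_less zero_less_Suc less_trans gr_zeroI not_less0)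
    then show ?thesis using that by (simp add: Suc_diff_Suc inf_commute)
  qed
  then show ?thesis using assms by (auto simp: is_chain_def)
qed

text \<open>A common point \<open>p\<close> of the two neighbourhoods is joined to \<open>A\<close> and to \<open>B\<close> by chains of length at
  most \<open>w\<close>. The comparison of the diameters passes through both chains and the step between
  the last tiles, which meet in \<open>p\<close>; hence the exponent \<open>2 * w + 1\<close>.\<close>

lemma meeting_nbhds_estimate:
  assumes "A \<in> X n" "B \<in> X n" "tile_nbhd (X n) w A \<inter> tile_nbhd (X n) w B \<noteq> {}"
  shows "diam B \<le> C ^ (2 * w + 1) * diam A"
    and "\<lbrakk>x \<in> A; y \<in> B\<rbrakk> \<Longrightarrow> d x y \<le> 2 * (real w + 1) * C ^ (3 * w + 1) * diam A"
proof -
  obtain p A' B' k l Z Z' where A': "A' \<in> X n" "p \<in> A'" "k \<le> w" "is_chain (X n) k Z A A'"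
    and B': "B' \<in> X n" "p \<in> B'" "l \<le> w" "is_chain (X n) l Z' B B'"
    using assms(3) unfolding tile_nbhd_def by blast
  have pos: "0 < diam A" "0 < diam B" "0 < diam A'" "0 < diam B'" using diam_pos assms A' B' by auto
  have mono: "C ^ i \<le> C ^ j" if "i \<le> j" for i j using C_ge_1 that by (rule power_increasing[rotated])
  have "diam B \<le> C ^ l * diam B'" by (rule chain_estimate(1)[OF is_chain_reverse[OF B'(4)]])
  also have "\<dots> \<le> C ^ w * diam B'" using pos mono[OF B'(3)] by (intro mult_right_mono) auto
  also have "\<dots> \<le> C ^ w * (C * diam A')"
    using same_level[OF B'(1) A'(1)] A' B' C_ge_1 by (intro mult_left_mono) auto
  also have "\<dots> \<le> C ^ w * (C * (C ^ k * diam A))"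
    using chain_estimate(1)[OF A'(4)] C_ge_1 by (intro mult_left_mono) auto
  also have "\<dots> \<le> C ^ w * (C * (C ^ w * diam A))"
    using mono[OF A'(3)] C_ge_1 pos by (intro mult_left_mono mult_right_mono) auto
  also have "\<dots> = C ^ (2 * w + 1) * diam A" by (simp add: mult_2 power_add)
  finally show diam_B: "diam B \<le> C ^ (2 * w + 1) * diam A" .
  assume xy: "x \<in> A" "y \<in> B"
  have S: "x \<in> S" "y \<in> S" "p \<in> S" using xy A' assms tile_subset by blast+
  have relax: "(real j + 1) * C ^ j * diam D \<le> (real w + 1) * C ^ w * diam D"
    if "j \<le> w" "D \<in> X n" for j D
    using that mono[OF that(1)] diam_pos[OF that(2)] C_ge_1
    by (intro mult_right_mono mult_mono) auto
  have "d x y \<le> d x p + d y p" using triangle[of x p y] S by (simp add: commute)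
  also have "d x p \<le> (real w + 1) * C ^ w * diam A"
    using chain_estimate(2)[OF A'(4) xy(1) A'(2)] relax[OF A'(3) assms(1)] by linarith
  also have "\<dots> \<le> (real w + 1) * C ^ (3 * w + 1) * diam A"
    using pos mono[of w "3 * w + 1"] by (intro mult_right_mono mult_left_mono) auto
  also have "d y p \<le> (real w + 1) * C ^ w * diam B"
    using chain_estimate(2)[OF B'(4) xy(2) B'(2)] relax[OF B'(3) assms(2)] by linarith
  also have "\<dots> \<le> (real w + 1) * C ^ w * (C ^ (2 * w + 1) * diam A)"
    using diam_B C_ge_1 by (intro mult_left_mono) auto
  also have "\<dots> = (real w + 1) * C ^ (3 * w + 1) * diam A"
    by (simp add: power_add[symmetric] mult.assoc) 
  finally show "d x y \<le> 2 * (real w + 1) * C ^ (3 * w + 1) * diam A" by (simp add: algebra_simps)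
qed

text \<open>The tile that witnesses nearness may differ from the given tile at \<open>x\<close>, but the two meet in
  \<open>x\<close>, which costs one more factor \<open>C\<close>.\<close>

lemma near_upper_estimate:
  assumes "near X w n x y" "A \<in> X n" "x \<in> A"
  shows "d x y \<le> 2 * (real w + 1) * C ^ (3 * w + 2) * diam A"
proof -
  obtain A' B where *: "A' \<in> X n" "B \<in> X n" "x \<in> A'" "y \<in> B"
      "tile_nbhd (X n) w A' \<inter> tile_nbhd (X n) w B \<noteq> {}"
    using assms(1) unfolding near_def by blast
  have "d x y \<le> 2 * (real w + 1) * C ^ (3 * w + 1) * diam A'"
    by (rule meeting_nbhds_estimate(2)[OF *(1,2,5,3,4)])
  also have "\<dots> \<le> 2 * (real w + 1) * C ^ (3 * w + 1) * (C * diam A)"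
    using same_level[OF *(1) assms(2)] * assms C_ge_1 by (intro mult_left_mono) auto
  finally show ?thesis by (simp add: mult_ac)
qed

lemma not_near_lower_estimate:
  assumes "\<not> near X w n x y" "A \<in> X n" "x \<in> A" "y \<in> S"
  shows "diam A \<le> C * d x y"
proof -
  obtain B where B: "B \<in> X n" "y \<in> B" using assms(4) by (rule tile_containing)
  then have "diam A \<le> C * set_dist d A B"
    using separated assms unfolding near_def by blast
  also have "\<dots> \<le> C * d x y"
    using set_dist_lower[of d x A y B] nonneg assms B C_ge_1 by (intro mult_left_mono) auto
  finally show ?thesis .
qed

lemma diam_few_levels:
  assumes "A \<in> X p" "B \<in> X (p + j)" "x \<in> A" "x \<in> B"
  shows "diam B \<le> C ^ Suc j * diam A"
  using assms(2,4)
proof (induction j arbitrary: B)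
  case 0
  then show ?case using same_level[of B p A] assms by auto
next
  case (Suc j)
  have "x \<in> S" using assms tile_subset by blast
  then obtain D where D: "D \<in> X (p + j)" "x \<in> D" by (rule tile_containing)
  have "diam B \<le> C * diam D" using next_level_le[OF D(1)] D Suc.prems by auto
  also have "\<dots> \<le> C * (C ^ Suc j * diam A)" using Suc.IH[OF D] C_ge_1 by (intro mult_left_mono) auto
  finally show ?case by (simp add: mult_ac)
qed

text \<open>Every \<open>k\<^sub>0\<close> levels the diameter shrinks by the factor \<open>\<theta>\<close>; a remainder of fewer
  than \<open>k\<^sub>0\<close> levels costs at most the constant \<open>C ^ Suc k\<^sub>0\<close>.\<close>

lemma diam_decay:
  assumes "A \<in> X p" "B \<in> X (p + j)" "x \<in> A" "x \<in> B"
  shows "diam B \<le> C ^ Suc k\<^sub>0 * \<theta> ^ (j div k\<^sub>0) * diam A"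
  using assms(2,4)
proof (induction j arbitrary: B rule: less_induct)
  case (less j)
  show ?case
  proof (cases "j < k\<^sub>0")
    case True
    then have "C ^ Suc j \<le> C ^ Suc k\<^sub>0" using C_ge_1 by (intro power_increasing) auto
    then show ?thesis
      using True diam_few_levels[OF assms(1) less.prems(1) assms(3) less.prems(2)]
        diam_pos[OF assms(1)] mult_right_mono[of "C ^ Suc j" "C ^ Suc k\<^sub>0" "diam A"] by simp
  next
    case False
    have "x \<in> S" using assms tile_subset by blast
    then obtain D where D: "D \<in> X (p + (j - k\<^sub>0))" "x \<in> D" by (rule tile_containing)
    have "B \<in> X (p + (j - k\<^sub>0) + k\<^sub>0)" using less.prems False by simp
    then have "diam B \<le> \<theta> * diam D" using jump[OF D(1)] D less.prems by blast
    also have "\<dots> \<le> \<theta> * (C ^ Suc k\<^sub>0 * \<theta> ^ ((j - k\<^sub>0) div k\<^sub>0) * diam A)"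
      using less.IH[OF _ D] False k0_ge_1 \<theta> by (intro mult_left_mono) auto
    also have "\<dots> = C ^ Suc k\<^sub>0 * \<theta> ^ Suc ((j - k\<^sub>0) div k\<^sub>0) * diam A" by simp
    also have "Suc ((j - k\<^sub>0) div k\<^sub>0) = j div k\<^sub>0" using False k0_ge_1 by (simp add: le_div_geq)
    finally show ?thesis .
  qed
qed

text \<open>Points that are near at level \<open>n\<close> are at most a multiple of the diameter of a tile of level \<open>n\<close>
  apart, and after sufficiently many levels the decay absorbs this multiple.\<close>

lemma near_fine_level:
  assumes "0 < \<epsilon>"
  obtains N where "\<And>n p x y A. \<lbrakk>near X w n x y; A \<in> X p; x \<in> A; p + N \<le> n\<rbrakk> \<Longrightarrow> d x y \<le> \<epsilon> * diam A"
proof -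
  define K where "K = 2 * (real w + 1) * C ^ (3 * w + 2) * C ^ Suc k\<^sub>0"
  have K: "0 < K" using C_ge_1 by (simp add: K_def)
  obtain M where M: "\<theta> ^ M < \<epsilon> / K"
    using real_arch_pow_inv[of "\<epsilon> / K" \<theta>] assms K \<theta> by auto
  have "d x y \<le> \<epsilon> * diam A" if n: "near X w n x y" and A: "A \<in> X p" "x \<in> A" and le: "p + M * k\<^sub>0 \<le> n"
    for n p x y A
  proof -
    define j where "j = n - p"
    have "x \<in> S" using A tile_subset by blast
    then obtain B where B: "B \<in> X n" "x \<in> B" by (rule tile_containing)
    have "M \<le> j div k\<^sub>0" using le k0_ge_1 by (simp add: j_def less_eq_div_iff_mult_less_eq)
    then have "\<theta> ^ (j div k\<^sub>0) \<le> \<theta> ^ M" using \<theta> by (intro power_decreasing) auto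
    with M have small: "\<theta> ^ (j div k\<^sub>0) \<le> \<epsilon> / K" by linarith
    have "d x y \<le> 2 * (real w + 1) * C ^ (3 * w + 2) * diam B"
      by (rule near_upper_estimate[OF n B])
    also have "\<dots> \<le> 2 * (real w + 1) * C ^ (3 * w + 2) * (C ^ Suc k\<^sub>0 * \<theta> ^ (j div k\<^sub>0) * diam A)"
      using diam_decay[OF A(1), of B j x] A B le C_ge_1 by (intro mult_left_mono) (auto simp: j_def)
    also have "\<dots> = K * diam A * \<theta> ^ (j div k\<^sub>0)" by (simp add: K_def)
    also have "\<dots> \<le> K * diam A * (\<epsilon> / K)"
      using small K diam_pos[OF A(1)] by (intro mult_left_mono) auto
    also have "\<dots> = \<epsilon> * diam A" using K by simp
    finally show ?thesis .
  qed
  then show ?thesis by (rule that)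
qed

lemma proximity_finite:
  assumes "x \<in> S" "y \<in> S" "x \<noteq> y"
  shows "proximity X w x y \<noteq> \<infinity>"
proof -
  define \<epsilon> where "\<epsilon> = d x y / (2 * diam S)"
  have pos: "0 < d x y" using assms mdist_pos_eq by blast
  then have "0 < \<epsilon>" using diam_S_pos by (simp add: \<epsilon>_def)
  then obtain N where N: "\<And>n p x y A. \<lbrakk>near X w n x y; A \<in> X p; x \<in> A; p + N \<le> n\<rbrakk> \<Longrightarrow> d x y \<le> \<epsilon> * diam A"
    using near_fine_level by blast
  have "n \<le> N" if "near X w n x y" for n
  proof (rule ccontr)
    assume "\<not> n \<le> N"
    then have "d x y \<le> \<epsilon> * diam S" using N[OF that, of S 0] level_zero assms by simp
    also have "\<dots> = d x y / 2" using diam_S_pos by (simp add: \<epsilon>_def)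
    finally show False using pos by simp
  qed
  then have "proximity X w x y \<le> enat N" by (simp add: proximity_le_iff)
  then show ?thesis by (cases "proximity X w x y") auto
qed

text \<open>Condition by condition, a violation with a large constant makes some distance tiny compared
  with a tile for which it is also bounded below. The last condition needs the smallest \<open>\<epsilon>\<close>:
  there the sum of two tiny distances, one at \<open>x\<close> and one at \<open>y\<close>, is compared with a distance that
  is not tiny, and the tiles at \<open>x\<close> and \<open>y\<close> differ by the factor \<open>C ^ (2 * w + 1)\<close>.\<close>

lemma combinatorially_visual: "combinatorially_visual_approximation S X w"
proof -
  define \<epsilon> where "\<epsilon> = 1 / (4 * C ^ (2 * w + 3))"
  have \<epsilon>: "0 < \<epsilon>" using C_ge_1 by (simp add: \<epsilon>_def)
  then obtain N where N: "\<And>n p x y A. \<lbrakk>near X w n x y; A \<in> X p; x \<in> A; p + N \<le> n\<rbrakk> \<Longrightarrow> d x y \<le> \<epsilon> * diam A"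
    using near_fine_level by blast
  have \<epsilon>_le: "C ^ i * \<epsilon> \<le> 1 / 4" if "i \<le> 2 * w + 3" for i
    using power_increasing[OF that C_ge_1] C_ge_1 by (simp add: \<epsilon>_def field_simps)
  have proximity_bound: "proximity X w x y \<le> enat (n + N)"
    if "A \<in> X n" "x \<in> A" "\<epsilon> * diam A < d x y" for n A x y
    unfolding proximity_le_iff using N[OF _ that(1,2)] that(3) by (meson nat_le_linear not_le)
  have inside: "\<exists>x\<in>A. \<exists>y\<in>A. proximity X w x y \<le> enat (n + N)" if A: "A \<in> X n" for n A
  proof -
    have "\<epsilon> * diam A < diam A" using \<epsilon>_le[of 0] diam_pos[OF A] by simp
    then obtain x y where "x \<in> A" "y \<in> A" "\<epsilon> * diam A < d x y"
      using less_set_diamE[OF tile_nonempty[OF A]] by metis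
    then show ?thesis using proximity_bound[OF A] by blast
  qed
  have apart: "proximity X w x y \<le> enat (n + N)"
    if "A \<in> X n" "B \<in> X n" "tile_nbhd (X n) w A \<inter> tile_nbhd (X n) w B = {}" "x \<in> A" "y \<in> B"
    for n A B x y
  proof -
    have "diam A \<le> C * set_dist d A B" by (rule separated[OF that(1-3)])
    also have "\<dots> \<le> C * d x y"
      using set_dist_lower[of d x A y B] nonneg that C_ge_1 by (intro mult_left_mono) auto
    finally have below: "diam A \<le> C * d x y" .
    then have "\<epsilon> * diam A \<le> (C ^ 1 * \<epsilon>) * d x y"
      using mult_left_mono[of "diam A" "C * d x y" \<epsilon>] \<epsilon> by (simp add: mult_ac)
    also have "\<dots> \<le> 1 / 4 * d x y" by (intro mult_right_mono \<epsilon>_le) auto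
    also have "\<dots> < d x y"
    proof -
      have "0 < C * d x y" using below diam_pos[OF that(1)] by linarith
      then have "0 < d x y" using C_ge_1 by (simp add: zero_less_mult_iff)
      then show ?thesis by simp
    qed
    finally show ?thesis by (rule proximity_bound[OF that(1,4)])
  qed
  have ultra: "min (proximity X w x z) (proximity X w z y) \<le> proximity X w x y + enat N"
    if S: "x \<in> S" "y \<in> S" "z \<in> S" for x y z
  proof (rule ccontr)
    assume "\<not> ?thesis"
    then have gt: "proximity X w x y + enat N < proximity X w x z"
        "proximity X w x y + enat N < proximity X w z y" by (simp_all add: not_le)
    then obtain m where m: "proximity X w x y = enat m" by (cases "proximity X w x y") auto
    have "\<exists>n > m + N. near X w n u v" if "proximity X w x y + enat N < proximity X w u v" for u v
      using that proximity_le_iff[of X w u v "m + N"] by (auto simp: m not_le)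
    from this[OF gt(1)] this[OF gt(2)] obtain i j
      where i: "m + N < i" "near X w i x z" and j: "m + N < j" "near X w j z y" by blast
    have "S \<in> X 0" using level_zero by simp
    then have "near X w 0 x y" using near_same_tile S by metis
    then have "near X w m x y" using m by (rule near_proximity)
    then obtain A B where AB: "A \<in> X m" "B \<in> X m" "x \<in> A" "y \<in> B"
        "tile_nbhd (X m) w A \<inter> tile_nbhd (X m) w B \<noteq> {}"
      unfolding near_def by blast
    have pos: "0 < diam A" by (rule diam_pos[OF AB(1)])
    have "\<not> near X w (Suc m) x y" using near_le_proximity m by fastforce
    moreover obtain D where D: "D \<in> X (Suc m)" "x \<in> D" using S(1) by (rule tile_containing)
    ultimately have "diam D \<le> C * d x y" using not_near_lower_estimate S by blast
    then have below: "diam A \<le> C * (C * d x y)"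
      using next_level_ge[OF AB(1) D(1)] AB D C_ge_1 mult_left_mono[of "diam D" "C * d x y" C]
      by fastforce
    have "d x z \<le> \<epsilon> * diam A" using N[OF i(2) AB(1,3)] i by simp
    moreover have "d y z \<le> \<epsilon> * diam B" using N[OF near_sym[OF j(2)] AB(2,4)] j by simp
    moreover have "\<epsilon> * diam B \<le> \<epsilon> * (C ^ (2 * w + 1) * diam A)"
      using meeting_nbhds_estimate(1)[OF AB(1,2,5)] \<epsilon> by (intro mult_left_mono) auto
    moreover have "d x y \<le> d x z + d y z" using triangle'[of x z y] S by (simp add: commute)
    ultimately have "d x y \<le> \<epsilon> * diam A + \<epsilon> * (C ^ (2 * w + 1) * diam A)" by linarith
    then have "C * (C * d x y) \<le> C * (C * (\<epsilon> * diam A + \<epsilon> * (C ^ (2 * w + 1) * diam A)))"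
      using C_ge_1 by (intro mult_left_mono) auto
    also have "\<dots> = (C ^ 2 * \<epsilon>) * diam A + (C ^ (2 * w + 3) * \<epsilon>) * diam A"
      by (simp add: algebra_simps power2_eq_square power3_eq_cube power_add)
    also have "\<dots> \<le> 1 / 4 * diam A + 1 / 4 * diam A"
      using pos by (intro add_mono mult_right_mono \<epsilon>_le) auto
    finally show False using below pos by simp
  qed
  show ?thesis
    unfolding combinatorially_visual_iff
    by (intro conjI allI ballI impI exI[of _ N] cover level_zero proximity_finite inside)
      (use apart ultra in auto)
qed

end

lemma quasi_visual_imp_combinatorially_visual:
  assumes "Metric_space S d" "Metric_space.mbounded S d S" "quasi_visual_approximation S d X w"
  shows "combinatorially_visual_approximation S X w"
proof -
  obtain C :: real and k\<^sub>0 :: nat and \<theta> :: real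
    where two: "\<exists>x\<in>S. \<exists>y\<in>S. x \<noteq> y" and cov: "\<forall>n. is_cover S (X n)" and X0: "X 0 = {S}"
    and const: "1 \<le> C" "1 \<le> k\<^sub>0" "0 < \<theta>" "\<theta> < 1"
    and same: "\<forall>n. \<forall>A\<in>X n. \<forall>B\<in>X n. A \<inter> B \<noteq> {} \<longrightarrow>
           1 / C * set_diam d B \<le> set_diam d A \<and> set_diam d A \<le> C * set_diam d B"
    and sep: "\<forall>n. \<forall>A\<in>X n. \<forall>B\<in>X n. tile_nbhd (X n) w A \<inter> tile_nbhd (X n) w B = {} \<longrightarrow>
           set_dist d A B \<ge> 1 / C * set_diam d A"
    and next_level: "\<forall>n. \<forall>A\<in>X n. \<forall>B\<in>X (n + 1). A \<inter> B \<noteq> {} \<longrightarrow>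
           1 / C * set_diam d B \<le> set_diam d A \<and> set_diam d A \<le> C * set_diam d B"
    and jump: "\<forall>n. \<forall>A\<in>X n. \<forall>B\<in>X (n + k\<^sub>0). A \<inter> B \<noteq> {} \<longrightarrow>
           set_diam d B \<le> \<theta> * set_diam d A"
    using assms(3) unfolding quasi_visual_approximation_def by (elim conjE exE) (rule that)
  have flip: "1 / C * a \<le> b \<longleftrightarrow> a \<le> C * b" for a b using const by (simp add: field_simps)
  note same = same[unfolded flip] and sep = sep[unfolded flip] and next_level = next_level[unfolded flip]
  interpret Metric_space S d by fact
  have "quasi_visual S d X w C k\<^sub>0 \<theta>"
  proof unfold_locales
    show "is_cover S (X n)" for n using cov by (rule spec)
  qed (use two X0 const same sep next_level jump assms(2) in simp_all)
  then show ?thesis by (rule quasi_visual.combinatorially_visual)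
qed

section \<open>Chain metrics\<close>

text \<open>In Frink's construction a chain of points costs the sum of \<open>q\<close> over its links. The end
  points of a chain are not confined to the carrier, so that the set of costs is never empty and
  the infimum is nonnegative and symmetric for arbitrary arguments, as for metrics on a carrier.\<close>

definition chain_costs :: "'a set \<Rightarrow> ('a \<Rightarrow> 'a \<Rightarrow> real) \<Rightarrow> 'a \<Rightarrow> 'a \<Rightarrow> real set" where
  "chain_costs S q x y = {\<Sum>i<n. q (f i) (f (Suc i)) |n f.
     f 0 = x \<and> f n = y \<and> (\<forall>i. 0 < i \<and> i < n \<longrightarrow> f i \<in> S)}"

definition chain_metric :: "'a set \<Rightarrow> ('a \<Rightarrow> 'a \<Rightarrow> real) \<Rightarrow> 'a \<Rightarrow> 'a \<Rightarrow> real" where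
  "chain_metric S q x y = Inf (chain_costs S q x y)"

locale quasi_ultrametric =
  fixes S :: "'a set" and q :: "'a \<Rightarrow> 'a \<Rightarrow> real" and K :: real
  assumes nonneg: "0 \<le> q x y" and commute: "q x y = q y x"
    and zero: "\<lbrakk>x \<in> S; y \<in> S\<rbrakk> \<Longrightarrow> q x y = 0 \<longleftrightarrow> x = y"
    and ultra: "\<lbrakk>x \<in> S; y \<in> S; z \<in> S\<rbrakk> \<Longrightarrow> q x y \<le> K * max (q x z) (q z y)"
    and K_ge_1: "1 \<le> K" and K_square: "K\<^sup>2 \<le> 2"
begin

lemma single_link: "q x y \<in> chain_costs S q x y"
  unfolding chain_costs_def
  by (intro CollectI exI[of _ 1] exI[of _ "\<lambda>i. if i = 0 then x else y"]) auto

lemma chain_costs_nonneg: "c \<in> chain_costs S q x y \<Longrightarrow> 0 \<le> c"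
  unfolding chain_costs_def by (auto intro: sum_nonneg nonneg)

lemma chain_costs_reverse:
  assumes "c \<in> chain_costs S q x y"
  shows "c \<in> chain_costs S q y x"
proof -
  obtain n f where f: "c = (\<Sum>i<n. q (f i) (f (Suc i)))" "f 0 = x" "f n = y"
      "\<forall>i. 0 < i \<and> i < n \<longrightarrow> f i \<in> S"
    using assms unfolding chain_costs_def by blast
  have "c = (\<Sum>i<n. q (f (n - Suc i)) (f (Suc (n - Suc i))))"
    unfolding f(1) by (rule sum.nat_diff_reindex[symmetric])
  also have "\<dots> = (\<Sum>i<n. q (f (n - i)) (f (n - Suc i)))"
    by (intro sum.cong) (auto simp: Suc_diff_Suc commute)
  finally show ?thesis
    unfolding chain_costs_def using f
    by (intro CollectI exI[of _ n] exI[of _ "\<lambda>i. f (n - i)"]) auto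
qed

lemma chain_costs_append:
  assumes "b \<in> chain_costs S q x y" "c \<in> chain_costs S q y z" "y \<in> S"
  shows "b + c \<in> chain_costs S q x z"
proof -
  obtain n f where f: "b = (\<Sum>i<n. q (f i) (f (Suc i)))" "f 0 = x" "f n = y"
      "\<forall>i. 0 < i \<and> i < n \<longrightarrow> f i \<in> S"
    using assms(1) unfolding chain_costs_def by blast
  obtain m g where g: "c = (\<Sum>i<m. q (g i) (g (Suc i)))" "g 0 = y" "g m = z"
      "\<forall>i. 0 < i \<and> i < m \<longrightarrow> g i \<in> S"
    using assms(2) unfolding chain_costs_def by blast
  define h where "h i = (if i \<le> n then f i else g (i - n))" for i
  have "h i \<in> S" if "0 < i" "i < n + m" for i
    using that f g assms(3) by (cases i n rule: linorder_cases) (auto simp: h_def)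
  moreover have "h 0 = x" "h (n + m) = z" using f g by (auto simp: h_def)
  moreover have "b + c = (\<Sum>i<n + m. q (h i) (h (Suc i)))"
  proof -
    have h_right: "h (n + i) = g i" for i using f g by (simp add: h_def)
    have "(\<Sum>i<n + m. q (h i) (h (Suc i)))
        = (\<Sum>i<n. q (h i) (h (Suc i))) + (\<Sum>i<m. q (h (n + i)) (h (n + Suc i)))"
      by (induction m) (auto simp: add.assoc)
    also have "(\<Sum>i<n. q (h i) (h (Suc i))) = b" unfolding f(1) by (intro sum.cong) (auto simp: h_def)
    finally show ?thesis unfolding h_right g(1) by simp
  qed
  ultimately show ?thesis unfolding chain_costs_def by blast
qed

text \<open>Applying the inequality once at \<open>u\<close> and once at \<open>v\<close> costs the factor \<open>K\<^sup>2 \<le> 2\<close>.\<close>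

lemma ultra4:
  assumes "x \<in> S" "u \<in> S" "v \<in> S" "y \<in> S" "q x u \<le> t" "q u v \<le> t" "q v y \<le> t"
  shows "q x y \<le> 2 * t"
proof -
  have t: "0 \<le> t" using nonneg[of x u] assms(5) by linarith
  have "q u y \<le> K * max (q u v) (q v y)" using assms by (intro ultra)
  also have "\<dots> \<le> K * t" using assms K_ge_1 by (intro mult_left_mono) auto
  finally have "q u y \<le> K * t" .
  moreover have "t \<le> K * t" using K_ge_1 t by (simp add: mult_le_cancel_right1)
  ultimately have "max (q x u) (q u y) \<le> K * t" using assms(5) by auto
  then have "K * max (q x u) (q u y) \<le> K * (K * t)" using K_ge_1 by (intro mult_left_mono) auto
  also have "\<dots> = K\<^sup>2 * t" by (simp add: power2_eq_square)
  also have "\<dots> \<le> 2 * t" using K_square t by (rule mult_right_mono)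
  finally show ?thesis using ultra[of x y u] assms by linarith
qed

text \<open>The chain is cut at the link where the cost first reaches half of the total. Each of the two parts
  next to that link costs at most half of the total, so that induction bounds \<open>q\<close> on either part by
  the total cost; the link itself costs at most the total as well. The two applications of the
  ultrametric inequality that rejoin the three pieces lose the factor \<open>K\<^sup>2 \<le> 2\<close>.\<close>

lemma link_sum_lower:
  assumes "a \<le> b" and "\<And>i. \<lbrakk>a \<le> i; i \<le> b\<rbrakk> \<Longrightarrow> f i \<in> S"
  shows "q (f a) (f b) \<le> 2 * (\<Sum>i=a..<b. q (f i) (f (Suc i)))"
  using assms
proof (induction "b - a" arbitrary: a b rule: less_induct)
  case less
  show ?case
  proof (cases "a = b")
    case True
    then show ?thesis using less.prems zero[of "f a" "f a"] by simp
  next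
    case False
    let ?c = "\<lambda>i j. \<Sum>l=i..<j. q (f l) (f (Suc l))"
    define t where "t = ?c a b"
    have t: "0 \<le> t" unfolding t_def by (intro sum_nonneg nonneg)
    define P where "P k \<longleftrightarrow> a < k \<and> t / 2 \<le> ?c a k" for k
    have "P b" using False less.prems t by (simp add: P_def t_def)
    define k where "k = (LEAST k. P k)"
    have "P k" unfolding k_def using \<open>P b\<close> by (rule LeastI)
    have "k \<le> b" unfolding k_def using \<open>P b\<close> by (rule Least_le)
    obtain i where i: "k = Suc i" "a \<le> i" using \<open>P k\<close> unfolding P_def by (cases k) auto
    have left: "?c a i \<le> t / 2"
    proof (cases "i = a")
      case False
      moreover have "\<not> P i" using not_less_Least[of i P] i by (simp add: k_def)
      ultimately show ?thesis using i by (simp add: P_def)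
    qed (use t in simp)
    have split: "t = ?c a k + ?c k b"
      unfolding t_def using i \<open>k \<le> b\<close> by (subst sum.atLeastLessThan_concat) auto
    have right: "?c k b \<le> t / 2" using split \<open>P k\<close> by (simp add: P_def)
    have "?c a k = ?c a i + q (f i) (f k)" using i by simp
    moreover have "0 \<le> ?c a i" "0 \<le> ?c k b" by (auto intro: sum_nonneg nonneg)
    ultimately have mid: "q (f i) (f k) \<le> t" using split by linarith
    have "q (f a) (f i) \<le> 2 * ?c a i"
      using i \<open>k \<le> b\<close> less.prems by (intro less.hyps) auto
    moreover have "q (f k) (f b) \<le> 2 * ?c k b"
      using i \<open>k \<le> b\<close> less.prems by (intro less.hyps) auto
    moreover have "f a \<in> S" "f i \<in> S" "f k \<in> S" "f b \<in> S"
      using i \<open>k \<le> b\<close> less.prems by auto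
    ultimately show ?thesis
      using ultra4[of "f a" "f i" "f k" "f b" t] left mid right unfolding t_def by linarith
  qed
qed

lemma chain_metric_le: "chain_metric S q x y \<le> q x y"
  unfolding chain_metric_def using single_link chain_costs_nonneg
  by (intro cInf_lower bdd_belowI[of _ 0])

lemma chain_metric_ge:
  assumes "x \<in> S" "y \<in> S"
  shows "q x y / 2 \<le> chain_metric S q x y"
  unfolding chain_metric_def
proof (rule cInf_greatest)
  fix c assume "c \<in> chain_costs S q x y"
  then obtain n f where f: "c = (\<Sum>i<n. q (f i) (f (Suc i)))" "f 0 = x" "f n = y"
      "\<forall>i. 0 < i \<and> i < n \<longrightarrow> f i \<in> S"
    unfolding chain_costs_def by blast
  have "f i \<in> S" if "i \<le> n" for i
    using f assms that by (cases "i = 0 \<or> i = n") auto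
  then show "q x y / 2 \<le> c" using link_sum_lower[of 0 n f] f by (simp add: lessThan_atLeast0)
qed (use single_link in blast)

lemma Metric_space_chain_metric: "Metric_space S (chain_metric S q)"
proof
  fix x y
  show "0 \<le> chain_metric S q x y"
    unfolding chain_metric_def using single_link[of x y] chain_costs_nonneg by (intro cInf_greatest) auto
  have "chain_costs S q x y = chain_costs S q y x" using chain_costs_reverse by blast
  then show "chain_metric S q x y = chain_metric S q y x" by (simp add: chain_metric_def)
next
  fix x y assume S: "x \<in> S" "y \<in> S"
  have "q x y / 2 \<le> chain_metric S q x y" by (rule chain_metric_ge[OF S])
  moreover have "chain_metric S q x y \<le> q x y" by (rule chain_metric_le)
  moreover have "0 \<le> q x y" by (rule nonneg)
  ultimately show "chain_metric S q x y = 0 \<longleftrightarrow> x = y"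
    using zero[OF S] by linarith
next
  fix x y z assume S: "x \<in> S" "y \<in> S" "z \<in> S"
  have bdd: "bdd_below (chain_costs S q x z)" for x z
    using chain_costs_nonneg by (intro bdd_belowI[of _ 0])
  have le: "chain_metric S q x z \<le> b + c" if "b \<in> chain_costs S q x y" "c \<in> chain_costs S q y z" for b c
    unfolding chain_metric_def using chain_costs_append[OF that S(2)] bdd by (rule cInf_lower)
  have "chain_metric S q x z - b \<le> chain_metric S q y z" if "b \<in> chain_costs S q x y" for b
    using single_link[of y z] le[OF that] unfolding chain_metric_def[of S q y z]
    by (intro cInf_greatest) (auto simp: algebra_simps)
  then have "chain_metric S q x z - chain_metric S q y z \<le> chain_metric S q x y"
    using single_link[of x y] unfolding chain_metric_def[of S q x y]
    by (intro cInf_greatest) (auto simp: algebra_simps)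
  then show "chain_metric S q x z \<le> chain_metric S q x y + chain_metric S q y z" by simp
qed

end

section \<open>Combinatorially visual approximations are visual\<close>

text \<open>This is \<open>\<Lambda>\<close> to the power \<open>- m\<close>, with value zero at infinity.\<close>

definition level_weight :: "real \<Rightarrow> enat \<Rightarrow> real" where
  "level_weight \<Lambda> m = (case m of enat n \<Rightarrow> 1 / \<Lambda> ^ n | \<infinity> \<Rightarrow> 0)"

lemma level_weight_enat [simp]: "level_weight \<Lambda> (enat n) = 1 / \<Lambda> ^ n"
  and level_weight_infinity [simp]: "level_weight \<Lambda> \<infinity> = 0"
  by (simp_all add: level_weight_def)

lemma level_weight_antimono:
  assumes "1 < \<Lambda>" "m \<le> n"
  shows "level_weight \<Lambda> n \<le> level_weight \<Lambda> m"
  using assms by (cases m; cases n) (auto intro!: divide_left_mono power_increasing)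

lemma level_weight_add: "level_weight \<Lambda> (m + enat N) = level_weight \<Lambda> m / \<Lambda> ^ N"
  by (cases m) (auto simp: power_add)

text \<open>The diameter of a tile of level \<open>n\<close> is bounded above because all its points are near at
  level \<open>n\<close>, and below by the pair of points that the tile contains by assumption; points of tiles
  with disjoint neighbourhoods are far apart because their proximity is at most \<open>n + N\<close>. The factor
  \<open>2 * \<Lambda> ^ N\<close> accounts for the chain construction and the additive constant.\<close>

lemma combinatorially_visual_imp_visual:
  assumes "combinatorially_visual_approximation S X w"
  obtains d \<Lambda> where "Metric_space S d" "Metric_space.mbounded S d S" "1 < \<Lambda>"
    "visual_approximation S d X w \<Lambda>"
proof -
  obtain N where cover: "\<forall>n. is_cover S (X n)" and X0: "X 0 = {S}"
    and finite: "\<forall>x\<in>S. \<forall>y\<in>S. x \<noteq> y \<longrightarrow> proximity X w x y \<noteq> \<infinity>"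
    and inside_tile: "\<forall>n. \<forall>A\<in>X n. \<exists>x\<in>A. \<exists>y\<in>A. proximity X w x y \<le> enat (n + N)"
    and separated: "\<forall>n. \<forall>A\<in>X n. \<forall>B\<in>X n. tile_nbhd (X n) w A \<inter> tile_nbhd (X n) w B = {} \<longrightarrow>
           (\<forall>x\<in>A. \<forall>y\<in>B. proximity X w x y \<le> enat (n + N))"
    and min_le: "\<forall>x\<in>S. \<forall>y\<in>S. \<forall>z\<in>S.
           min (proximity X w x z) (proximity X w z y) \<le> proximity X w x y + enat N"
    using assms unfolding combinatorially_visual_iff by (elim conjE exE) (rule that)
  note cov = cover[rule_format] and fin = finite[rule_format] and inside = inside_tile[rule_format]
    and apart = separated[rule_format] and ultra = min_le[rule_format]
  define \<Lambda> where "\<Lambda> = root (2 * N + 1) 2"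
  have \<Lambda>: "1 < \<Lambda>" by (simp add: \<Lambda>_def)
  \<comment> \<open>The visual parameter is chosen so that the quasi-ultrametric constant \<open>\<Lambda> ^ N\<close> is at most
    the square root of two.\<close>
  have "\<Lambda> ^ (2 * N) \<le> \<Lambda> ^ (2 * N + 1)" using \<Lambda> by (intro power_increasing) auto
  also have "\<dots> = 2" unfolding \<Lambda>_def by (rule real_root_pow_pos2) auto
  finally have K: "(\<Lambda> ^ N)\<^sup>2 \<le> 2" by (simp add: power_mult[symmetric] mult.commute)
  have pow: "0 < \<Lambda> ^ n" for n using \<Lambda> by simp
  define q where "q x y = level_weight \<Lambda> (proximity X w x y)" for x y
  interpret quasi_ultrametric S q "\<Lambda> ^ N"
  proof
    fix x y
    show "0 \<le> q x y" using \<Lambda> by (auto simp: q_def level_weight_def split: enat.split)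
    show "q x y = q y x" by (simp add: q_def proximity_commute)
  next
    fix x y assume "x \<in> S" "y \<in> S"
    then show "q x y = 0 \<longleftrightarrow> x = y"
      using fin[of x y] proximity_self[of S X x w] cov \<Lambda>
      by (cases "x = y"; cases "proximity X w x y") (auto simp: q_def)
  next
    fix x y z assume S: "x \<in> S" "y \<in> S" "z \<in> S"
    have "q x y / \<Lambda> ^ N = level_weight \<Lambda> (proximity X w x y + enat N)"
      by (simp add: q_def level_weight_add)
    also have "\<dots> \<le> level_weight \<Lambda> (min (proximity X w x z) (proximity X w z y))"
      by (rule level_weight_antimono[OF \<Lambda> ultra[OF S]])
    also have "\<dots> \<le> max (q x z) (q z y)" by (auto simp: q_def min_def)
    finally show "q x y \<le> \<Lambda> ^ N * max (q x z) (q z y)" using pow[of N] by (simp add: field_simps)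
  qed (use \<Lambda> K in auto)
  let ?d = "chain_metric S q"
  have metric: "Metric_space S ?d" by (rule Metric_space_chain_metric)
  interpret M: Metric_space S ?d by (rule metric)
  have upper: "?d x y \<le> 1 / \<Lambda> ^ n" if "A \<in> X n" "x \<in> A" "y \<in> A" for n A x y
  proof -
    have "enat n \<le> proximity X w x y" using near_same_tile[of A X n x y w] that by (intro near_le_proximity)
    then have "q x y \<le> 1 / \<Lambda> ^ n" using level_weight_antimono[OF \<Lambda>] by (fastforce simp: q_def)
    then show ?thesis using chain_metric_le[of x y] by linarith
  qed
  define C where "C = 2 * \<Lambda> ^ N"
  have C: "1 \<le> C" using one_le_power[of \<Lambda> N] \<Lambda> unfolding C_def by linarith
  have lower: "1 / C * (1 / \<Lambda> ^ n) \<le> ?d x y" if "x \<in> S" "y \<in> S" "proximity X w x y \<le> enat (n + N)" for n x y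
  proof -
    have "1 / \<Lambda> ^ (n + N) \<le> q x y" using level_weight_antimono[OF \<Lambda> that(3)] by (simp add: q_def)
    then show ?thesis using chain_metric_ge[OF that(1,2)] by (simp add: C_def power_add mult_ac)
  qed
  have sub: "A \<subseteq> S" if "A \<in> X n" for A n using cov[of n] that unfolding is_cover_def by blast
  have bounded: "M.mbounded S"
    unfolding M.mbounded_alt using upper[of S 0] X0 by auto
  have powi: "\<Lambda> powi (- int n) = 1 / \<Lambda> ^ n" for n
    using \<Lambda> by (simp add: power_int_minus inverse_eq_divide)
  have "visual_approximation S ?d X w \<Lambda>"
    unfolding visual_approximation_def powi
  proof (intro conjI allI cov X0 exI[of _ C] C ballI impI)
    fix n A assume A: "A \<in> X n"
    obtain x y where xy: "x \<in> A" "y \<in> A" "proximity X w x y \<le> enat (n + N)" using inside[OF A] by blast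
    have "1 / C * (1 / \<Lambda> ^ n) \<le> ?d x y" using lower xy sub[OF A] by blast
    also have "\<dots> \<le> set_diam ?d A" using upper[OF A] xy(1,2) by (rule set_diam_upper)
    finally show "1 / C * (1 / \<Lambda> ^ n) \<le> set_diam ?d A" .
    have "set_diam ?d A \<le> 1 / \<Lambda> ^ n" using upper[OF A] xy(1) by (intro set_diam_least) auto
    also have "\<dots> \<le> C * (1 / \<Lambda> ^ n)" using C pow[of n] by (simp add: divide_right_mono)
    finally show "set_diam ?d A \<le> C * (1 / \<Lambda> ^ n)" .
  next
    fix n A B assume AB: "A \<in> X n" "B \<in> X n" "tile_nbhd (X n) w A \<inter> tile_nbhd (X n) w B = {}"
    have "A \<noteq> {}" "B \<noteq> {}" using inside AB by blast+
    moreover have "1 / C * (1 / \<Lambda> ^ n) \<le> ?d x y" if "x \<in> A" "y \<in> B" for x y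
      using that sub AB(1,2) by (intro lower apart[OF AB]) auto
    ultimately show "1 / C * (1 / \<Lambda> ^ n) \<le> set_dist ?d A B" by (rule set_dist_greatest)
  qed
  with metric bounded \<Lambda> show ?thesis by (rule that)
qed

theorem theorem8p2:
  fixes S :: "'a set" and X :: "nat \<Rightarrow> 'a set set" and w :: nat
  assumes "\<And>n. is_cover S (X n)"
  shows "((\<exists>\<rho>. Metric_space S \<rho> \<and> Metric_space.mbounded S \<rho> S \<and>
             (\<exists>\<Lambda>>1. visual_approximation S \<rho> X w \<Lambda>))
          \<longleftrightarrow>
          (\<exists>d. Metric_space S d \<and> Metric_space.mbounded S d S \<and>
             quasi_visual_approximation S d X w))
         \<and>
         ((\<exists>d. Metric_space S d \<and> Metric_space.mbounded S d S \<and>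
             quasi_visual_approximation S d X w)
          \<longleftrightarrow>
          combinatorially_visual_approximation S X w)"
    (is "(?visual \<longleftrightarrow> ?quasi) \<and> (?quasi \<longleftrightarrow> ?comb)")
proof -
  have "?visual \<Longrightarrow> ?quasi" using visual_imp_quasi_visual by metis
  moreover have "?quasi \<Longrightarrow> ?comb" using quasi_visual_imp_combinatorially_visual by metis
  moreover have "?comb \<Longrightarrow> ?visual" using combinatorially_visual_imp_visual by metis
  ultimately show ?thesis by blast
qed

end
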